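(* Let $\mu\geq 0$ be a real number and define $$\theta_{\mu}(x)=\left(\frac{2}{\mu!}\,\Gamma\left(\frac{x}{2}\right)\Gamma\left(\frac{x}{2}+\mu+1\right)\zeta_{\mu}(x)\right)^{\frac{1}{x}}$$ for real $x>1$. Then the function $\log\theta_{\mu}(x)$ is strictly increasing for $x>8e(\mu+2)^2$.
   Context: For a real number $\mu>-1$, the Bessel function of the first kind of order $\mu$ is $$J_{\mu}(z)=\left(\frac{z}{2}\right)^{\mu}\sum_{k=0}^{\infty}\frac{(-1)^k}{\Gamma(\mu+k+1)k!}\left(\frac{z}{2}\right)^{2k}.$$ It has infinitely many positive real zeros, denoted $0<j_{\mu,1}<j_{\mu,2}<j_{\mu,3}<\cdots$. The Bessel zeta function is $\zeta_{\mu}(x)=\sum_{n=1}^{\infty}\frac{1}{j_{\mu,n}^x}$ (for $x>1$). Here $\Gamma$ is the gamma function, $\mu!=\Gamma(\mu+1)$, and $e$ is the base of the natural logarithm. *)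

theory Defs
  imports "HOL-Analysis.Analysis"
begin

text \<open>Only positive arguments \<open>z\<close> are meaningful below; in particular
  \<open>0 powr 0 = 0\<close> in HOL, so the value at \<open>z = 0\<close>, \<open>\<mu> = 0\<close> is not the usual one.\<close>

definition bessel_J :: "real \<Rightarrow> real \<Rightarrow> real" where
  "bessel_J \<mu> z =
     (z / 2) powr \<mu> *
     (\<Sum>k. (-1) ^ k / (Gamma (\<mu> + real k + 1) * fact k) * (z / 2) ^ (2 * k))"

text \<open>For \<open>n \<ge> 1\<close>, \<open>bessel_zero \<mu> n\<close> is the \<open>n\<close>-th positive zero \<open>j\<^sub>\<mu>\<^sub>,\<^sub>n\<close>; the value \<open>0\<close> at
  index \<open>0\<close> is only the starting point of the recursion.\<close>

primrec bessel_zero :: "real \<Rightarrow> nat \<Rightarrow> real" where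
  "bessel_zero \<mu> 0 = 0"
| "bessel_zero \<mu> (Suc n) = (LEAST z. bessel_zero \<mu> n < z \<and> bessel_J \<mu> z = 0)"

lemma bessel_zero_eq_enumeration:
  assumes mono: "strict_mono j" and range: "range j = {z. 0 < z \<and> bessel_J \<mu> z = 0}"
  shows "bessel_zero \<mu> (Suc n) = j n"
proof (induction n)
  case 0
  have "(LEAST z. 0 < z \<and> bessel_J \<mu> z = 0) = j 0"
  proof (rule Least_equality)
    show "0 < j 0 \<and> bessel_J \<mu> (j 0) = 0" using range by blast
    fix y assume "0 < y \<and> bessel_J \<mu> y = 0"
    then obtain m where "y = j m" using range by blast
    then show "j 0 \<le> y" using mono by (simp add: strict_mono_less_eq)
  qed
  then show ?case by simp
next
  case (Suc n)
  have "(LEAST z. j n < z \<and> bessel_J \<mu> z = 0) = j (Suc n)"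
  proof (rule Least_equality)
    show "j n < j (Suc n) \<and> bessel_J \<mu> (j (Suc n)) = 0"
      using range mono by (auto simp: strict_mono_less)
    fix y assume y: "j n < y \<and> bessel_J \<mu> y = 0"
    have "0 < j n" using range by blast
    with y have "y \<in> range j" unfolding range by simp
    then obtain m where m: "y = j m" by blast
    then have "n < m" using y mono by (simp add: strict_mono_less)
    then show "j (Suc n) \<le> y" using m mono by (simp add: strict_mono_less_eq)
  qed
  then show ?case using Suc.IH by (metis bessel_zero.simps(2))
qed

definition bessel_zeta :: "real \<Rightarrow> real \<Rightarrow> real" where
  "bessel_zeta \<mu> x = (\<Sum>n. 1 / bessel_zero \<mu> (Suc n) powr x)"

text \<open>Here \<open>\<mu>!\<close> is \<open>Gamma (\<mu> + 1)\<close>; the function is meant for \<open>x > 1\<close>.\<close>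

definition theta :: "real \<Rightarrow> real \<Rightarrow> real" where
  "theta \<mu> x =
     (2 / Gamma (\<mu> + 1) * Gamma (x / 2) * Gamma (x / 2 + \<mu> + 1) * bessel_zeta \<mu> x) powr (1 / x)"

end

theory Submission
  imports Defs
begin

text \<open>
  Write \<open>j\<^sub>0 < j\<^sub>1 < \<dots>\<close> for the positive zeros of \<open>J\<^sub>\<mu>\<close>, counted from \<open>0\<close>, and let
  \<open>R x = (\<Sum>n. (j\<^sub>0 / j\<^sub>n\<^sub>+\<^sub>1) powr x)\<close>, so that \<open>\<zeta>\<^sub>\<mu> x = (1 + R x) / j\<^sub>0 powr x\<close>. The factor
  \<open>j\<^sub>0 powr x\<close> contributes only the constant \<open>- ln j\<^sub>0\<close> to \<open>ln (\<theta>\<^sub>\<mu> x)\<close>. What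
  remains of the zeta function is \<open>ln (1 + R x) / x\<close>, which works against the claim because it
  decreases, but only slowly: \<open>ln (1 + R x) / x - C / x\<close> is nondecreasing for \<open>C = 3 j\<^sub>0\<close>
  (\<open>ln_ratio_tail_decrease\<close>). It remains to move \<open>C\<close> into the Gamma part. With \<open>X = x / 2\<close> and
  \<open>c = ln 2 + C\<close>, this leaves, up to a factor \<open>1/2\<close>, the sum of
  \<open>(ln_Gamma X + c) / X\<close>, strictly increasing once \<open>X \<ge> c + 2\<close> because the trigamma
  function is at least \<open>1 / X\<close> (\<open>ln_Gamma_plus_const_div_strict_mono\<close>), and of
  \<open>(ln_Gamma (X + \<mu> + 1) - ln_Gamma (\<mu> + 1)) / X\<close>, a chord slope of the convex function
  \<open>ln_Gamma\<close> from a fixed point (\<open>ln_Gamma_slope_mono\<close>). Under \<open>x > 8 e (\<mu> + 2)\<^sup>2\<close> the condition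
  \<open>X \<ge> c + 2\<close> follows from any bound on \<open>j\<^sub>0\<close> that is linear in \<open>\<mu>\<close> with moderate constants.

  What this needs to know about the zeros is modest: there are infinitely many, consecutive ones are
  at least \<open>1\<close> apart, and \<open>j\<^sub>0 \<le> 2 \<mu> + 9\<close>. All three come from Bessel's differential equation.
  For \<open>g z = (z / 2) powr (- \<mu>) * J\<^sub>\<mu> z\<close> it reads
  \<open>g'' + (2 \<mu> + 1) / z * g' + g = 0\<close>. The energy \<open>g\<^sup>2 + g'\<^sup>2\<close> is nonincreasing, and it is positive
  since it becomes nondecreasing when multiplied by \<open>z powr (2 (2 \<mu> + 1))\<close>. So \<open>|g'|\<close> to the
  right of a critical point \<open>p\<close> is at most \<open>|g p| > 0\<close>, and \<open>g\<close> needs at least unit length to fall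
  from \<open>g p\<close> to the next zero (\<open>bessel_reg_zeros_separated\<close>). Conversely, the
  function \<open>z powr (\<mu> + 1/2) * g z\<close> satisfies an equation \<open>u'' + q u = 0\<close> with \<open>q \<ge> 1/4\<close> on
  \<open>[2 \<mu> + 1, \<infinity>)\<close>, and comparison with \<open>sin (z / 2)\<close> puts a zero in every
  interval of length \<open>2 \<pi>\<close> there (\<open>bessel_reg_zero_exists\<close>).
\<close>

section \<open>The regularised Bessel function and its differential equation\<close>

lemma has_real_derivative_powr_log:
  fixes x :: real
  assumes "x > 0"
  shows "((\<lambda>x. x powr p) has_real_derivative p / x * x powr p) (at x)"
  using has_real_derivative_powr[OF assms, of p] assms by (simp add: powr_diff)

definition bessel_coeff :: "real \<Rightarrow> nat \<Rightarrow> real" where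
  "bessel_coeff \<mu> k = (-1) ^ k / (Gamma (\<mu> + real k + 1) * fact k)"

text \<open>Up to the substitution \<open>t = z\<^sup>2 / 4\<close> this is \<open>J\<^sub>\<mu>\<close> without its branch factor
  \<open>(z / 2) powr \<mu>\<close>. As a power series in \<open>t\<close> it can be differentiated termwise.\<close>
definition bessel_entire :: "real \<Rightarrow> real \<Rightarrow> real" where
  "bessel_entire \<mu> t = (\<Sum>k. bessel_coeff \<mu> k * t ^ k)"

text \<open>In the variable \<open>z\<close> the zeros are the Bessel zeros themselves, and the coefficient of the
  undifferentiated term in the equation is \<open>1\<close>, which the energy argument uses.\<close>
definition bessel_reg :: "real \<Rightarrow> real \<Rightarrow> real" where
  "bessel_reg \<mu> z = bessel_entire \<mu> (z\<^sup>2 / 4)"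

definition bessel_reg' :: "real \<Rightarrow> real \<Rightarrow> real" where
  "bessel_reg' \<mu> z = z / 2 * (\<Sum>k. diffs (bessel_coeff \<mu>) k * (z\<^sup>2 / 4) ^ k)"

lemma bessel_J_eq_bessel_reg: "bessel_J \<mu> z = (z / 2) powr \<mu> * bessel_reg \<mu> z"
  by (simp add: bessel_J_def bessel_reg_def bessel_entire_def bessel_coeff_def power_mult
      power_divide)

text \<open>The functional equation of \<open>Gamma\<close> in terms of the coefficients. It drives both the convergence
  of the series and the differential equation.\<close>
lemma bessel_coeff_Suc:
  assumes "\<mu> > -1"
  shows "bessel_coeff \<mu> (Suc k) * (real (Suc k) * (\<mu> + real k + 1)) = - bessel_coeff \<mu> k"
proof -
  have pos: "\<mu> + real k + 1 > 0" using assms by simp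
  have "Gamma (\<mu> + real (Suc k) + 1) = (\<mu> + real k + 1) * Gamma (\<mu> + real k + 1)"
    using Gamma_plus1[of "\<mu> + real k + 1"] pos by (simp add: algebra_simps nonpos_Ints_def)
  moreover have "Gamma (\<mu> + real k + 1) > 0" using pos by (rule Gamma_real_pos)
  ultimately show ?thesis using pos
    by (simp add: bessel_coeff_def divide_simps del: of_nat_Suc)
qed

text \<open>By the recurrence, consecutive terms have ratio at most \<open>1/2\<close> as soon as
  \<open>k (\<mu> + 1) \<ge> 2 |t|\<close>, so a geometric series dominates from there on.\<close>
lemma summable_bessel_entire:
  assumes "\<mu> > -1"
  shows "summable (\<lambda>k. bessel_coeff \<mu> k * t ^ k)"
proof -
  obtain N :: nat where N: "real N \<ge> \<bar>t\<bar> * 2 / (\<mu> + 1)" using real_arch_simple by blast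
  show ?thesis
  proof (rule summable_comparison_test')
    show "summable (\<lambda>k. \<bar>bessel_coeff \<mu> N\<bar> * \<bar>t\<bar> ^ N * (1/2) ^ (k - N))"
      by (intro summable_mult) (subst summable_iff_shift[of _ N, symmetric], simp)
    show "norm (bessel_coeff \<mu> k * t ^ k) \<le> \<bar>bessel_coeff \<mu> N\<bar> * \<bar>t\<bar> ^ N * (1/2) ^ (k - N)"
      if "k \<ge> N" for k
      using that
    proof (induction k rule: dec_induct)
      case base
      then show ?case by (simp add: abs_mult power_abs)
    next
      case (step k)
      have pos: "real (Suc k) * (\<mu> + real k + 1) > 0" using assms by simp
      have "\<bar>t\<bar> * 2 \<le> real N * (\<mu> + 1)" using N assms by (simp add: field_simps)
      also have "\<dots> \<le> real (Suc k) * (\<mu> + real k + 1)"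
        using step assms by (intro mult_mono) auto
      finally have t: "\<bar>t\<bar> * 2 \<le> real (Suc k) * (\<mu> + real k + 1)" .
      have "\<bar>bessel_coeff \<mu> (Suc k)\<bar> * (real (Suc k) * (\<mu> + real k + 1)) = \<bar>bessel_coeff \<mu> k\<bar>"
        using bessel_coeff_Suc[OF assms, of k] pos
        by (metis abs_minus_cancel abs_mult abs_of_pos)
      moreover have "\<bar>bessel_coeff \<mu> (Suc k)\<bar> * (\<bar>t\<bar> * 2)
          \<le> \<bar>bessel_coeff \<mu> (Suc k)\<bar> * (real (Suc k) * (\<mu> + real k + 1))"
        using t by (intro mult_left_mono) auto
      ultimately have "\<bar>bessel_coeff \<mu> (Suc k)\<bar> * \<bar>t\<bar> \<le> \<bar>bessel_coeff \<mu> k\<bar> / 2" by simp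
      from mult_right_mono[OF this, of "\<bar>t\<bar> ^ k"]
      have "norm (bessel_coeff \<mu> (Suc k) * t ^ Suc k) \<le> norm (bessel_coeff \<mu> k * t ^ k) / 2"
        by (simp add: abs_mult power_abs algebra_simps)
      also have "\<dots> \<le> \<bar>bessel_coeff \<mu> N\<bar> * \<bar>t\<bar> ^ N * (1/2) ^ (k - N) / 2"
        using step.IH by simp
      finally show ?case using step by (simp add: Suc_diff_le)
    qed
  qed
qed

text \<open>Comparing coefficients of \<open>t ^ k\<close> turns the equation
  \<open>t f'' + (\<mu> + 1) f' + f = 0\<close> into the recurrence \<open>bessel_coeff_Suc\<close>.\<close>
lemma bessel_entire_ode:
  assumes "\<mu> > -1"
  shows "t * (\<Sum>k. diffs (diffs (bessel_coeff \<mu>)) k * t ^ k)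
    + (\<mu> + 1) * (\<Sum>k. diffs (bessel_coeff \<mu>) k * t ^ k) + bessel_entire \<mu> t = 0"
proof -
  let ?c = "bessel_coeff \<mu>"
  have s0: "summable (\<lambda>k. ?c k * t ^ k)" for t by (rule summable_bessel_entire[OF assms])
  have s1: "summable (\<lambda>k. diffs ?c k * t ^ k)" for t by (rule termdiff_converges_all[OF s0])
  have s2: "summable (\<lambda>k. diffs (diffs ?c) k * t ^ k)" for t by (rule termdiff_converges_all[OF s1])
  have "(\<lambda>k. real k * diffs ?c k * t ^ k) sums (t * (\<Sum>k. diffs (diffs ?c) k * t ^ k))"
  proof -
    have "(\<lambda>k. t * (diffs (diffs ?c) k * t ^ k)) sums (t * (\<Sum>k. diffs (diffs ?c) k * t ^ k))"
      by (intro sums_mult summable_sums s2)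
    then have "(\<lambda>k. real (Suc k) * diffs ?c (Suc k) * t ^ Suc k)
        sums (t * (\<Sum>k. diffs (diffs ?c) k * t ^ k))"
      by (simp add: diffs_def algebra_simps)
    then show ?thesis by (subst (asm) sums_Suc_iff) simp
  qed
  moreover have "(\<lambda>k. (\<mu> + 1) * (diffs ?c k * t ^ k))
      sums ((\<mu> + 1) * (\<Sum>k. diffs ?c k * t ^ k))"
    by (intro sums_mult summable_sums s1)
  moreover have "(\<lambda>k. ?c k * t ^ k) sums bessel_entire \<mu> t"
    unfolding bessel_entire_def by (intro summable_sums s0)
  ultimately have "(\<lambda>k. real k * diffs ?c k * t ^ k + (\<mu> + 1) * (diffs ?c k * t ^ k) + ?c k * t ^ k)
      sums (t * (\<Sum>k. diffs (diffs ?c) k * t ^ k) + (\<mu> + 1) * (\<Sum>k. diffs ?c k * t ^ k)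
        + bessel_entire \<mu> t)"
    by (intro sums_add)
  moreover have "real k * diffs ?c k * t ^ k + (\<mu> + 1) * (diffs ?c k * t ^ k) + ?c k * t ^ k = 0" for k
  proof -
    have "real k * diffs ?c k * t ^ k + (\<mu> + 1) * (diffs ?c k * t ^ k) + ?c k * t ^ k
      = (?c (Suc k) * (real (Suc k) * (\<mu> + real k + 1)) + ?c k) * t ^ k"
      by (simp add: diffs_def algebra_simps)
    then show ?thesis by (simp only: bessel_coeff_Suc[OF assms]) simp
  qed
  ultimately show ?thesis by (simp add: sums_unique2[OF _ sums_zero])
qed

lemma has_real_derivative_bessel_reg:
  assumes "\<mu> > -1"
  shows "(bessel_reg \<mu> has_real_derivative bessel_reg' \<mu> z) (at z)"
proof -
  have D: "(bessel_entire \<mu> has_real_derivative (\<Sum>k. diffs (bessel_coeff \<mu>) k * t ^ k)) (at t)" for t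
    unfolding bessel_entire_def
    by (rule termdiffs_strong_converges_everywhere[OF summable_bessel_entire[OF assms]])
  show ?thesis unfolding bessel_reg_def bessel_reg'_def
    by (rule DERIV_cong[OF DERIV_chain2[OF D, where Db = "z / 2"]])
      (auto intro!: derivative_eq_intros)
qed

text \<open>This is \<open>g'' + (2 \<mu> + 1) / z * g' + g = 0\<close>, the equation \<open>bessel_entire_ode\<close> after the
  substitution \<open>t = z\<^sup>2 / 4\<close>.\<close>
lemma has_real_derivative_bessel_reg':
  assumes "\<mu> > -1" "z > 0"
  shows "(bessel_reg' \<mu> has_real_derivative - (2 * \<mu> + 1) / z * bessel_reg' \<mu> z - bessel_reg \<mu> z) (at z)"
proof -
  let ?F1 = "\<lambda>t. (\<Sum>k. diffs (bessel_coeff \<mu>) k * t ^ k)"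
  let ?F2 = "\<lambda>t. (\<Sum>k. diffs (diffs (bessel_coeff \<mu>)) k * t ^ k)"
  have D: "(?F1 has_real_derivative ?F2 t) (at t)" for t
    by (intro termdiffs_strong_converges_everywhere termdiff_converges_all
        summable_bessel_entire assms)
  have "(bessel_reg' \<mu> has_real_derivative
      1 / 2 * ?F1 (z\<^sup>2 / 4) + z / 2 * (?F2 (z\<^sup>2 / 4) * (z / 2))) (at z)"
    unfolding bessel_reg'_def
    by (rule derivative_eq_intros DERIV_chain2[OF D] refl | simp)+
  moreover have "1 / 2 * ?F1 (z\<^sup>2 / 4) + z / 2 * (?F2 (z\<^sup>2 / 4) * (z / 2))
      = - (2 * \<mu> + 1) / z * bessel_reg' \<mu> z - bessel_reg \<mu> z"
  proof -
    define A where "A = ?F1 (z\<^sup>2 / 4)"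
    define B where "B = ?F2 (z\<^sup>2 / 4)"
    have "bessel_reg \<mu> z = - (z\<^sup>2 / 4 * B) - (\<mu> + 1) * A"
      using bessel_entire_ode[OF assms(1), of "z\<^sup>2 / 4"]
      by (simp add: bessel_reg_def A_def B_def)
    moreover have "bessel_reg' \<mu> z = z / 2 * A" by (simp add: bessel_reg'_def A_def)
    ultimately show ?thesis using assms(2)
      unfolding A_def[symmetric] B_def[symmetric] by (simp add: divide_simps) algebra
  qed
  ultimately show ?thesis by simp
qed

lemma bessel_reg_0_pos: "\<mu> > -1 \<Longrightarrow> bessel_reg \<mu> 0 > 0"
  using powser_zero[of "bessel_coeff \<mu>"]
  by (simp add: bessel_reg_def bessel_entire_def bessel_coeff_def Gamma_real_pos)

section \<open>Separation of the zeros\<close>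

text \<open>The first-order term \<open>(2 \<mu> + 1) / z * g'\<close> acts as friction on the harmonic oscillator
  \<open>g'' + g = 0\<close>, whose energy is \<open>g\<^sup>2 + g'\<^sup>2\<close>.\<close>
definition bessel_energy :: "real \<Rightarrow> real \<Rightarrow> real" where
  "bessel_energy \<mu> z = (bessel_reg \<mu> z)\<^sup>2 + (bessel_reg' \<mu> z)\<^sup>2"

lemma has_real_derivative_bessel_energy:
  assumes "\<mu> > -1" "z > 0"
  shows "(bessel_energy \<mu> has_real_derivative - 2 * (2 * \<mu> + 1) / z * (bessel_reg' \<mu> z)\<^sup>2) (at z)"
  unfolding bessel_energy_def using assms
  by (auto intro!: derivative_eq_intros has_real_derivative_bessel_reg
      has_real_derivative_bessel_reg' simp: field_simps power2_eq_square)

lemma bessel_energy_antimono: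
  assumes "\<mu> \<ge> -1/2" "0 < x" "x \<le> y"
  shows "bessel_energy \<mu> y \<le> bessel_energy \<mu> x"
  by (rule DERIV_nonpos_imp_nonincreasing[OF assms(3)])
    (use assms in \<open>auto intro!: exI has_real_derivative_bessel_energy mult_nonpos_nonneg
      divide_nonpos_pos\<close>)

text \<open>The energy dissipates no faster than like \<open>z powr (- m)\<close> with \<open>m = 2 (2 \<mu> + 1)\<close>, since
  \<open>z powr m * bessel_energy \<mu> z\<close> has a nonnegative derivative. If it vanished at one point,
  it would vanish all the way down to \<open>0\<close>, where the function is nonzero. In particular all
  positive zeros are simple, and the function vanishes on no interval.\<close>
lemma bessel_energy_pos:
  assumes "\<mu> \<ge> -1/2" "z > 0"
  shows "bessel_energy \<mu> z > 0"
proof (rule ccontr)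
  assume "\<not> bessel_energy \<mu> z > 0"
  then have E0: "bessel_energy \<mu> z \<le> 0" by simp
  let ?m = "2 * (2 * \<mu> + 1)"
  have D: "((\<lambda>s. s powr ?m * bessel_energy \<mu> s) has_real_derivative
      s powr ?m * (?m / s * (bessel_reg \<mu> s)\<^sup>2)) (at s)" if "s > 0" for s
  proof -
    have "((\<lambda>s. s powr ?m * bessel_energy \<mu> s) has_real_derivative
        ?m / s * s powr ?m * bessel_energy \<mu> s
        + (- 2 * (2 * \<mu> + 1) / s * (bessel_reg' \<mu> s)\<^sup>2) * s powr ?m) (at s)"
      using that assms
      by (intro DERIV_mult has_real_derivative_powr_log has_real_derivative_bessel_energy) auto
    then show ?thesis
      by (rule DERIV_cong) (use that in \<open>simp add: bessel_energy_def field_simps\<close>)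
  qed
  have zero: "bessel_reg \<mu> s = 0" if s: "0 < s" "s \<le> z" for s
  proof -
    have "s powr ?m * bessel_energy \<mu> s \<le> z powr ?m * bessel_energy \<mu> z"
    proof (rule DERIV_nonneg_imp_nondecreasing[OF s(2)])
      fix r assume "s \<le> r"
      then have r: "r > 0" using s by simp
      have "0 \<le> r powr ?m * (?m / r * (bessel_reg \<mu> r)\<^sup>2)"
        using r assms by (intro mult_nonneg_nonneg divide_nonneg_pos) auto
      with D[OF r] show "\<exists>d. ((\<lambda>s. s powr ?m * bessel_energy \<mu> s)
          has_real_derivative d) (at r) \<and> 0 \<le> d" by blast
    qed
    also have "\<dots> \<le> 0" using E0 by (simp add: mult_nonneg_nonpos)
    finally have "bessel_energy \<mu> s \<le> 0" using s by (simp add: mult_le_0_iff)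
    then show ?thesis unfolding bessel_energy_def by (simp add: sum_power2_le_zero_iff)
  qed
  have "isCont (bessel_reg \<mu>) 0"
    using has_real_derivative_bessel_reg[of \<mu> 0] assms by (auto intro: DERIV_isCont)
  then have "(bessel_reg \<mu> \<longlongrightarrow> bessel_reg \<mu> 0) (at_right 0)"
    unfolding isCont_def by (rule tendsto_within_subset) simp
  moreover have "eventually (\<lambda>s. bessel_reg \<mu> s = 0) (at_right 0)"
    using assms zero by (auto simp: eventually_at_right[of 0 1] intro!: exI[of _ z])
  then have "(bessel_reg \<mu> \<longlongrightarrow> 0) (at_right 0)" by (rule tendsto_eventually)
  ultimately have "bessel_reg \<mu> 0 = 0" by (rule tendsto_unique[rotated]) simp
  then show False using bessel_reg_0_pos[of \<mu>] assms by simp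
qed

text \<open>Between two zeros \<open>a < b\<close> Rolle gives a critical point \<open>c\<close>, where the energy is just the
  square of the value. Since the energy does not grow, the slope beyond \<open>c\<close> is at most the value
  at \<open>c\<close> in modulus, so a drop to \<open>0\<close> takes at least unit length.\<close>
lemma bessel_reg_zeros_separated:
  assumes "\<mu> \<ge> -1/2" "0 < a" "a < b" "bessel_reg \<mu> a = 0" "bessel_reg \<mu> b = 0"
  shows "a + 1 \<le> b"
proof -
  have D: "(bessel_reg \<mu> has_real_derivative bessel_reg' \<mu> z) (at z)" for z
    by (rule has_real_derivative_bessel_reg) (use assms in simp)
  obtain c where c: "a < c" "c < b" "bessel_reg' \<mu> c = 0"
    using MVT2[OF assms(3), of "bessel_reg \<mu>" "bessel_reg' \<mu>"] D assms by auto
  obtain d where d: "c < d" "d < b" "bessel_reg \<mu> b - bessel_reg \<mu> c = (b - c) * bessel_reg' \<mu> d"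
    using MVT2[OF c(2), of "bessel_reg \<mu>" "bessel_reg' \<mu>"] D by auto
  have "(bessel_reg' \<mu> d)\<^sup>2 \<le> bessel_energy \<mu> d" by (simp add: bessel_energy_def)
  also have "\<dots> \<le> bessel_energy \<mu> c"
    by (rule bessel_energy_antimono) (use assms c d in auto)
  also have "\<dots> = (bessel_reg \<mu> c)\<^sup>2" using c by (simp add: bessel_energy_def)
  finally have le: "\<bar>bessel_reg' \<mu> d\<bar> \<le> \<bar>bessel_reg \<mu> c\<bar>" by (simp add: abs_le_square_iff)
  have "bessel_energy \<mu> c > 0" using assms c by (intro bessel_energy_pos) auto
  then have nz: "\<bar>bessel_reg \<mu> c\<bar> > 0" using c by (simp add: bessel_energy_def)
  have "\<bar>bessel_reg \<mu> c\<bar> = (b - c) * \<bar>bessel_reg' \<mu> d\<bar>"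
    using d assms by (simp add: abs_mult flip: abs_minus_cancel[of "bessel_reg \<mu> c"])
  also have "\<dots> \<le> (b - c) * \<bar>bessel_reg \<mu> c\<bar>" using le c by (intro mult_left_mono) auto
  finally have "1 \<le> b - c" using nz by simp
  then show ?thesis using c by simp
qed

section \<open>Existence of zeros\<close>

text \<open>Sturm comparison with \<open>sin (k (z - a))\<close>: if \<open>u\<close> keeps the sign of \<open>u a\<close>, the Wronskian \<open>W\<close> of
  \<open>u\<close> and the sine, multiplied by \<open>u a\<close> to treat both signs together, is nonincreasing on the half
  period; but it is negative at the left end and positive at the right end.\<close>
lemma sturm_zero:
  fixes u u' q :: "real \<Rightarrow> real"
  assumes k: "k > 0"
    and D: "\<And>z. a \<le> z \<Longrightarrow> z \<le> a + pi / k \<Longrightarrow> (u has_real_derivative u' z) (at z)"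
    and D': "\<And>z. a \<le> z \<Longrightarrow> z \<le> a + pi / k \<Longrightarrow> (u' has_real_derivative - q z * u z) (at z)"
    and q: "\<And>z. a \<le> z \<Longrightarrow> z \<le> a + pi / k \<Longrightarrow> k\<^sup>2 \<le> q z"
  shows "\<exists>z\<in>{a..a + pi / k}. u z = 0"
proof (rule ccontr)
  assume no: "\<not> ?thesis"
  let ?b = "a + pi / k"
  have ab: "a \<le> ?b" using k by simp
  have "continuous_on {a..?b} u"
    using D by (meson DERIV_isCont atLeastAtMost_iff continuous_at_imp_continuous_on)
  then have conn: "connected (u ` {a..?b})"
    by (intro connected_continuous_image) auto
  have same_sign: "u a * u z > 0" if "z \<in> {a..?b}" for z
  proof (rule ccontr)
    assume "\<not> u a * u z > 0"
    then have "(u a \<le> 0 \<and> 0 \<le> u z) \<or> (u z \<le> 0 \<and> 0 \<le> u a)"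
      by (auto simp: zero_less_mult_iff not_less)
    moreover have "u a \<in> u ` {a..?b}" "u z \<in> u ` {a..?b}" using that ab by auto
    ultimately have "0 \<in> u ` {a..?b}" using conn unfolding connected_iff_interval by blast
    then show False using no by auto
  qed
  define W where "W z = u a * (u' z * sin (k * (z - a)) - k * u z * cos (k * (z - a)))" for z
  have "W ?b \<le> W a"
  proof (rule DERIV_nonpos_imp_nonincreasing[OF ab])
    fix z assume z: "a \<le> z" "z \<le> ?b"
    have "(W has_real_derivative (k\<^sup>2 - q z) * (u a * u z) * sin (k * (z - a))) (at z)"
      unfolding W_def
      by (auto intro!: derivative_eq_intros D[OF z] D'[OF z] simp: algebra_simps power2_eq_square)
    moreover have "(k\<^sup>2 - q z) * (u a * u z) * sin (k * (z - a)) \<le> 0"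
    proof -
      have "k * (z - a) \<le> pi" using z k by (simp add: field_simps)
      then have "sin (k * (z - a)) \<ge> 0" using z k by (intro sin_ge_zero) auto
      moreover have "(k\<^sup>2 - q z) * (u a * u z) \<le> 0"
        using q[OF z] same_sign[of z] z by (intro mult_nonpos_nonneg) auto
      ultimately show ?thesis by (rule mult_nonpos_nonneg[rotated])
    qed
    ultimately show "\<exists>y. (W has_real_derivative y) (at z) \<and> y \<le> 0" by blast
  qed
  moreover have "W ?b = k * (u a * u ?b)" "W a = - k * (u a * u a)"
    using k by (simp_all add: W_def)
  moreover have "k * (u a * u ?b) > 0" "k * (u a * u a) > 0"
    using same_sign[of ?b] same_sign[of a] ab k by auto
  ultimately show False by simp
qed

text \<open>The factor \<open>z powr (\<mu> + 1/2)\<close> removes the first-order term. The remaining coefficient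
  \<open>q z = 1 - (\<mu>\<^sup>2 - 1/4) / z\<^sup>2\<close> exceeds \<open>3/4\<close> for \<open>z \<ge> 2 \<mu>\<close>; comparison with frequency \<open>1/2\<close> is
  precise enough for the bound on the first zero.\<close>
lemma bessel_reg_zero_exists:
  assumes "\<mu> \<ge> 0" "a \<ge> 2 * \<mu> + 1"
  shows "\<exists>z\<in>{a..a + 2 * pi}. bessel_reg \<mu> z = 0"
proof -
  let ?p = "\<mu> + 1/2"
  define u where "u z = z powr ?p * bessel_reg \<mu> z" for z
  define u' where "u' z = z powr ?p * (bessel_reg' \<mu> z + ?p / z * bessel_reg \<mu> z)" for z
  define q where "q z = 1 - (\<mu>\<^sup>2 - 1/4) / z\<^sup>2" for z :: real
  have a: "a > 0" using assms by simp
  have "\<exists>z\<in>{a..a + pi / (1/2)}. u z = 0"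
  proof (rule sturm_zero[where q = q and u' = u'])
    fix z assume "a \<le> z"
    then have z: "z > 0" "2 * \<mu> \<le> z" using a assms by auto
    have P: "((\<lambda>z. z powr ?p) has_real_derivative ?p / z * z powr ?p) (at z)"
      by (rule has_real_derivative_powr_log[OF z(1)])
    have G: "(bessel_reg \<mu> has_real_derivative bessel_reg' \<mu> z) (at z)"
      by (rule has_real_derivative_bessel_reg) (use assms in simp)
    have G': "(bessel_reg' \<mu> has_real_derivative
        - (2 * \<mu> + 1) / z * bessel_reg' \<mu> z - bessel_reg \<mu> z) (at z)"
      by (rule has_real_derivative_bessel_reg') (use assms z in auto)
    show "(u has_real_derivative u' z) (at z)"
      unfolding u_def[abs_def] u'_def
      by (rule DERIV_cong[OF DERIV_mult[OF P G]]) (simp add: algebra_simps)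
    have Q: "((\<lambda>z. ?p / z) has_real_derivative - ?p / z\<^sup>2) (at z)"
      using z by (auto intro!: derivative_eq_intros simp: power2_eq_square)
    show "(u' has_real_derivative - q z * u z) (at z)"
      unfolding u_def u'_def[abs_def] q_def using z
      by (intro DERIV_cong[OF DERIV_mult[OF P DERIV_add[OF G' DERIV_mult[OF Q G]]]])
        (simp add: field_simps power2_eq_square)
    have "(2 * \<mu>)\<^sup>2 \<le> z\<^sup>2" using z assms by (intro power_mono) auto
    then have "(\<mu>\<^sup>2 - 1/4) / z\<^sup>2 \<le> 1/4"
      using z by (simp add: divide_le_eq power_mult_distrib)
    then show "(1/2)\<^sup>2 \<le> q z" unfolding q_def power2_eq_square[of "1/2"] by simp
  qed simp
  then obtain z where "z \<in> {a..a + 2 * pi}" "u z = 0" by (auto simp: mult.commute)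
  moreover from this have "z > 0" using a by auto
  ultimately show ?thesis by (auto simp: u_def)
qed

section \<open>The enumeration of the zeros\<close>

lemma bessel_J_eq_0_iff: "z > 0 \<Longrightarrow> bessel_J \<mu> z = 0 \<longleftrightarrow> bessel_reg \<mu> z = 0"
  by (simp add: bessel_J_eq_bessel_reg)

text \<open>Separation replaces a closedness argument: a point of the set less than \<open>1\<close> above the
  infimum has no other point of the set below it.\<close>
lemma least_of_separated:
  fixes P :: "real \<Rightarrow> bool"
  assumes ex: "\<exists>z. P z" and bdd: "\<And>z. P z \<Longrightarrow> c \<le> z"
    and sep: "\<And>x y. P x \<Longrightarrow> P y \<Longrightarrow> x < y \<Longrightarrow> x + 1 \<le> y"
  shows "P (LEAST z. P z)" "\<And>z. P z \<Longrightarrow> (LEAST z. P z) \<le> z"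
proof -
  have bb: "bdd_below (Collect P)" using bdd by (auto intro!: bdd_belowI[where m = c])
  obtain x where x: "P x" "x < Inf (Collect P) + 1"
    using cInf_lessD[of "Collect P" "Inf (Collect P) + 1"] ex by auto
  have min: "x \<le> y" if "P y" for y
  proof (rule ccontr)
    assume "\<not> x \<le> y"
    then have "y + 1 \<le> x" using sep[OF that x(1)] by simp
    moreover have "Inf (Collect P) \<le> y" using that bb by (auto intro: cInf_lower)
    ultimately show False using x by simp
  qed
  have "(LEAST z. P z) = x" by (rule Least_equality) (use x min in auto)
  then show "P (LEAST z. P z)" "\<And>z. P z \<Longrightarrow> (LEAST z. P z) \<le> z" using x min by auto
qed

text \<open>These facts go together in one induction: \<open>LEAST\<close> in the recursion is meaningful only once a
  zero beyond the previous one exists and the zeros are known to be separated. For the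
  first zero the upper bound is \<open>2 \<mu> + 1 + 2 \<pi>\<close> at \<open>\<mu> \<ge> 0\<close>, as \<open>bessel_zero \<mu> 0 = 0\<close>.\<close>
lemma bessel_zero_Suc:
  assumes "\<mu> \<ge> 0"
  shows "0 \<le> bessel_zero \<mu> n" "bessel_zero \<mu> n < bessel_zero \<mu> (Suc n)"
    "bessel_reg \<mu> (bessel_zero \<mu> (Suc n)) = 0"
    "bessel_zero \<mu> (Suc n) \<le> max (2 * \<mu> + 1) (bessel_zero \<mu> n + 1) + 2 * pi"
proof -
  have step: "z < bessel_zero \<mu> (Suc n) \<and> bessel_reg \<mu> (bessel_zero \<mu> (Suc n)) = 0
      \<and> bessel_zero \<mu> (Suc n) \<le> max (2 * \<mu> + 1) (z + 1) + 2 * pi"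
    if z: "z = bessel_zero \<mu> n" "0 \<le> z" for n z
  proof -
    let ?P = "\<lambda>y. z < y \<and> bessel_J \<mu> y = 0"
    have P: "?P y \<longleftrightarrow> z < y \<and> bessel_reg \<mu> y = 0" for y
      using z bessel_J_eq_0_iff[of y \<mu>] by auto
    obtain y where y: "max (2 * \<mu> + 1) (z + 1) \<le> y" "y \<le> max (2 * \<mu> + 1) (z + 1) + 2 * pi"
        "bessel_reg \<mu> y = 0"
      using bessel_reg_zero_exists[OF assms, of "max (2 * \<mu> + 1) (z + 1)"] by auto
    then have Py: "?P y" unfolding P by auto
    have sep: "x + 1 \<le> y" if "?P x" "?P y" "x < y" for x y
      using that z assms unfolding P by (intro bessel_reg_zeros_separated[of \<mu>]) auto
    have least: "?P (LEAST y. ?P y)" "(LEAST y. ?P y) \<le> y"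
      by (rule least_of_separated[of ?P z]; use Py sep in force)+
    have "bessel_zero \<mu> (Suc n) = (LEAST y. ?P y)" using z by simp
    moreover have "bessel_reg \<mu> (LEAST y. ?P y) = 0" using least(1) P by blast
    ultimately show ?thesis using least y by simp
  qed
  have nonneg: "0 \<le> bessel_zero \<mu> n" for n
    by (induction n) (use step in \<open>simp, fastforce simp del: bessel_zero.simps(2)\<close>)
  show "0 \<le> bessel_zero \<mu> n" by (rule nonneg)
  show "bessel_zero \<mu> n < bessel_zero \<mu> (Suc n)"
    "bessel_reg \<mu> (bessel_zero \<mu> (Suc n)) = 0"
    "bessel_zero \<mu> (Suc n) \<le> max (2 * \<mu> + 1) (bessel_zero \<mu> n + 1) + 2 * pi"
    using step[OF refl nonneg] by blast+
qed

section \<open>Zeta sums over separated sequences\<close>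

text \<open>With \<open>v = r powr t\<close> this is the weighted arithmetic-geometric inequality
  \<open>v powr (s / t) \<le> (s / t) v + (1 - s / t)\<close>. The bound does not depend on \<open>r\<close>.\<close>
lemma powr_diff_le:
  fixes r :: real
  assumes r: "0 < r" "r \<le> 1" and st: "0 < s" "s < t"
  shows "r powr s - r powr t \<le> 1 - s / t"
proof -
  have "r powr s = (r powr t) powr (s / t) * 1 powr (1 - s / t)"
    using st by (simp add: powr_powr)
  also have "\<dots> \<le> s / t * r powr t + (1 - s / t) * 1"
    using r st by (intro Youngs_inequality_0) auto
  also have "s / t * r powr t \<le> 1 * r powr t"
    using st by (intro mult_right_mono) auto
  finally show ?thesis by simp
qed

text \<open>Splitting off the square of \<open>r\<close> before applying the uniform bound keeps a factor that can be
  summed over a sequence of ratios.\<close>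
lemma powr_diff_le_square:
  fixes r :: real
  assumes r: "0 < r" "r \<le> 1" and xy: "4 \<le> x" "x < y"
  shows "r powr x - r powr y \<le> r powr 2 * (2 * (y - x) / y)"
proof -
  have "r powr x - r powr y = r powr 2 * (r powr (x - 2) - r powr (y - 2))"
    by (simp add: right_diff_distrib flip: powr_add)
  also have "\<dots> \<le> r powr 2 * (1 - (x - 2) / (y - 2))"
    using r xy by (intro mult_left_mono powr_diff_le) auto
  also have "1 - (x - 2) / (y - 2) = (y - x) / (y - 2)" using xy by (simp add: field_simps)
  also have "\<dots> \<le> (y - x) / (y / 2)" using xy by (intro divide_left_mono) auto
  also have "(y - x) / (y / 2) = 2 * (y - x) / y" by simp
  finally show ?thesis using r by (simp add: mult_left_mono)
qed

text \<open>The sum starts at the second entry of the sequence, since the first ratio is \<open>1\<close> and does not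
  change with \<open>x\<close>.\<close>
definition ratio_tail :: "(nat \<Rightarrow> real) \<Rightarrow> real \<Rightarrow> real" where
  "ratio_tail j x = (\<Sum>n. (j 0 / j (Suc n)) powr x)"

locale separated_sequence =
  fixes j :: "nat \<Rightarrow> real"
  assumes pos: "0 < j 0" and separated: "j n + 1 \<le> j (Suc n)"
begin

lemma lower_bound: "j 0 + real n \<le> j n"
proof (induction n)
  case (Suc n)
  then show ?case using separated[of n] by simp
qed simp

lemma positive: "0 < j n"
  using lower_bound[of n] pos by simp

lemma ratio_bounds: "0 < j 0 / j (Suc n)" "j 0 / j (Suc n) \<le> 1"
  using lower_bound[of "Suc n"] positive[of "Suc n"] pos by auto

text \<open>A telescoping majorant makes the sum of the squared ratios at most \<open>j 0\<close>, so that one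
  number controls both the size of the tail and its rate of decrease.\<close>
lemma ratio_square_le:
  "(j 0 / j (Suc n)) powr 2 \<le> (j 0)\<^sup>2 * (1 / (j 0 + real n) - 1 / (j 0 + real (Suc n)))"
proof -
  have "(j 0 / j (Suc n)) powr 2 = (j 0)\<^sup>2 / (j (Suc n))\<^sup>2"
    using ratio_bounds[of n] by (simp add: power_divide)
  also have "\<dots> \<le> (j 0)\<^sup>2 / ((j 0 + real n) * (j 0 + real (Suc n)))"
  proof (intro divide_left_mono)
    have "(j 0 + real n) * (j 0 + real (Suc n)) \<le> j (Suc n) * j (Suc n)"
      using lower_bound[of "Suc n"] pos by (intro mult_mono) auto
    then show "(j 0 + real n) * (j 0 + real (Suc n)) \<le> (j (Suc n))\<^sup>2"
      by (simp add: power2_eq_square)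
  qed (use pos positive[of "Suc n"] in \<open>auto intro!: mult_pos_pos add_pos_nonneg\<close>)
  also have "\<dots> = (j 0)\<^sup>2 * (1 / (j 0 + real n) - 1 / (j 0 + real (Suc n)))"
  proof -
    have "j 0 + real n > 0" "j 0 + real (Suc n) > 0" using pos by auto
    then show ?thesis by (simp add: divide_simps)
  qed
  finally show ?thesis .
qed

lemma reciprocal_telescope:
  "(\<lambda>n. (j 0)\<^sup>2 * (1 / (j 0 + real n) - 1 / (j 0 + real (Suc n)))) sums j 0"
proof -
  have "(\<lambda>n. 1 / (j 0 + real n)) \<longlonglongrightarrow> 0"
    by (intro tendsto_divide_0[OF tendsto_const] filterlim_at_top_imp_at_infinity
        filterlim_tendsto_add_at_top[OF tendsto_const] filterlim_real_sequentially)
  from sums_mult[OF telescope_sums'[OF this], of "(j 0)\<^sup>2"] show ?thesis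
    using pos by (simp add: power2_eq_square)
qed

lemma summable_ratio:
  assumes "x \<ge> 2"
  shows "summable (\<lambda>n. (j 0 / j (Suc n)) powr x)"
proof (rule summable_comparison_test')
  show "summable (\<lambda>n. (j 0)\<^sup>2 * (1 / (j 0 + real n) - 1 / (j 0 + real (Suc n))))"
    using reciprocal_telescope by (rule sums_summable)
  fix n
  have "(j 0 / j (Suc n)) powr x \<le> (j 0 / j (Suc n)) powr 2"
    using ratio_bounds[of n] assms by (intro powr_mono') auto
  then show "norm ((j 0 / j (Suc n)) powr x)
      \<le> (j 0)\<^sup>2 * (1 / (j 0 + real n) - 1 / (j 0 + real (Suc n)))"
    using ratio_square_le[of n] by simp
qed

lemma ratio_tail_2_le: "ratio_tail j 2 \<le> j 0"
proof -
  have "ratio_tail j 2 \<le> (\<Sum>n. (j 0)\<^sup>2 * (1 / (j 0 + real n) - 1 / (j 0 + real (Suc n))))"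
    unfolding ratio_tail_def
    by (intro suminf_le ratio_square_le summable_ratio sums_summable[OF reciprocal_telescope]) simp
  then show ?thesis using sums_unique[OF reciprocal_telescope] by simp
qed

lemma ratio_tail_nonneg: "2 \<le> x \<Longrightarrow> 0 \<le> ratio_tail j x"
  unfolding ratio_tail_def by (intro suminf_nonneg summable_ratio) auto

lemma ratio_tail_le:
  assumes "2 \<le> x"
  shows "ratio_tail j x \<le> j 0"
proof -
  have "ratio_tail j x \<le> ratio_tail j 2"
    unfolding ratio_tail_def using assms ratio_bounds
    by (intro suminf_le summable_ratio powr_mono') (auto intro: less_imp_le)
  then show ?thesis using ratio_tail_2_le by simp
qed

text \<open>The termwise bound \<open>powr_diff_le_square\<close> gives a rate of decrease without differentiating
  the series.\<close>
lemma ratio_tail_diff_le: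
  assumes xy: "4 \<le> x" "x < y"
  shows "ratio_tail j x - ratio_tail j y \<le> j 0 * (2 * (y - x) / y)"
proof -
  let ?r = "\<lambda>n. j 0 / j (Suc n)"
  have "ratio_tail j x - ratio_tail j y = (\<Sum>n. ?r n powr x - ?r n powr y)"
    unfolding ratio_tail_def using xy by (intro suminf_diff summable_ratio) auto
  also have "\<dots> \<le> (\<Sum>n. ?r n powr 2 * (2 * (y - x) / y))"
    using xy ratio_bounds
    by (intro suminf_le powr_diff_le_square summable_diff summable_mult2 summable_ratio) auto
  also have "\<dots> = ratio_tail j 2 * (2 * (y - x) / y)"
    unfolding ratio_tail_def by (intro suminf_mult2[symmetric] summable_ratio) simp
  also have "\<dots> \<le> j 0 * (2 * (y - x) / y)"
    using ratio_tail_2_le xy by (intro mult_right_mono) auto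
  finally show ?thesis .
qed

lemma suminf_powr_eq:
  assumes "2 \<le> x"
  shows "(\<Sum>n. 1 / j n powr x) = (1 + ratio_tail j x) / j 0 powr x"
proof -
  have *: "(j 0 / j n) powr x = j 0 powr x * (1 / j n powr x)" for n
    using pos positive[of n] by (simp add: powr_divide)
  have "summable (\<lambda>n. (j 0 / j n) powr x)"
    using summable_ratio[OF assms] by (subst (asm) summable_Suc_iff)
  moreover from this have "(\<Sum>n. (j 0 / j n) powr x) = 1 + ratio_tail j x"
    unfolding ratio_tail_def using pos by (subst suminf_split_head) (auto simp: field_simps)
  ultimately have "(\<lambda>n. (j 0 / j n) powr x) sums (1 + ratio_tail j x)"
    by (simp add: sums_iff)
  then have "(\<lambda>n. (j 0 / j n) powr x / j 0 powr x) sums ((1 + ratio_tail j x) / j 0 powr x)"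
    by (rule sums_divide)
  then show ?thesis using pos by (simp add: * sums_iff)
qed

text \<open>The decrease splits into that of \<open>ln (1 + R)\<close>, at most \<open>2 j 0 (y - x) / y\<close>, and that of
  \<open>1 / x\<close> with coefficient \<open>ln (1 + R y) \<le> j 0\<close>. Both are multiples of \<open>1 / x - 1 / y\<close>, with
  factors \<open>2 j 0\<close> and \<open>j 0\<close>; this form of the bound lets it be absorbed into the Gamma part as
  an additive constant before dividing by \<open>x\<close>.\<close>
lemma ln_ratio_tail_decrease:
  assumes xy: "4 \<le> x" "x < y"
  shows "ln (1 + ratio_tail j x) / x - ln (1 + ratio_tail j y) / y \<le> 3 * j 0 / x - 3 * j 0 / y"
proof -
  let ?R = "ratio_tail j"
  have R: "0 \<le> ?R x" "0 \<le> ?R y" "?R y \<le> j 0"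
    using ratio_tail_nonneg[of x] ratio_tail_nonneg[of y] ratio_tail_le[of y] xy by auto
  have "ln (1 + ?R x) - ln (1 + ?R y) \<le> j 0 * (2 * (y - x) / y)"
  proof (cases "?R x \<le> ?R y")
    case True
    then have "ln (1 + ?R x) - ln (1 + ?R y) \<le> 0" using R by simp
    also have "\<dots> \<le> j 0 * (2 * (y - x) / y)" using pos xy by simp
    finally show ?thesis .
  next
    case False
    have "ln (1 + ?R x) - ln (1 + ?R y) \<le> ((1 + ?R x) - (1 + ?R y)) / (1 + ?R y)"
      using R by (intro ln_diff_le) auto
    also have "\<dots> \<le> ((1 + ?R x) - (1 + ?R y)) / 1"
      using R False by (intro divide_left_mono) auto
    finally show ?thesis using ratio_tail_diff_le[OF xy] by simp
  qed
  then have "(ln (1 + ?R x) - ln (1 + ?R y)) / x \<le> j 0 * (2 * (y - x) / y) / x"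
    using xy by (intro divide_right_mono) auto
  moreover have "ln (1 + ?R y) * (1 / x - 1 / y) \<le> j 0 * (1 / x - 1 / y)"
  proof (rule mult_right_mono)
    show "ln (1 + ?R y) \<le> j 0" using ln_add_one_self_le_self[of "?R y"] R by simp
    show "0 \<le> 1 / x - 1 / y" using xy by (simp add: field_simps)
  qed
  moreover have "j 0 * (2 * (y - x) / y) / x + j 0 * (1 / x - 1 / y) = 3 * j 0 / x - 3 * j 0 / y"
    using xy by (simp add: field_simps)
  moreover have "ln (1 + ?R x) / x - ln (1 + ?R y) / y
      = (ln (1 + ?R x) - ln (1 + ?R y)) / x + ln (1 + ?R y) * (1 / x - 1 / y)"
    using xy by (simp add: field_simps)
  ultimately show ?thesis by linarith
qed

end

section \<open>Slopes of the logarithmic Gamma function\<close>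

text \<open>Each term \<open>1 / (y + k)\<^sup>2\<close> of the trigamma series is at least \<open>1 / (y + k) - 1 / (y + k + 1)\<close>,
  which telescopes.\<close>
lemma trigamma_ge:
  fixes y :: real
  assumes "y > 0"
  shows "Polygamma 1 y \<ge> 1 / y"
proof -
  have "(\<lambda>k. inverse ((y + real k) ^ Suc 1)) sums ((-1) ^ Suc 1 * Polygamma 1 y / fact 1)"
    using assms by (intro Polygamma_LIMSEQ) auto
  then have P: "(\<lambda>k. 1 / (y + real k)\<^sup>2) sums Polygamma 1 y"
    by (simp add: field_simps power2_eq_square)
  have "(\<lambda>k. 1 / (y + real k)) \<longlonglongrightarrow> 0"
    by (intro tendsto_divide_0[OF tendsto_const] filterlim_at_top_imp_at_infinity
        filterlim_tendsto_add_at_top[OF tendsto_const] filterlim_real_sequentially)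
  then have T: "(\<lambda>k. 1 / (y + real k) - 1 / (y + real (Suc k))) sums (1 / y)"
    using telescope_sums' by fastforce
  show ?thesis
  proof (rule sums_le[OF _ T P])
    fix k
    have p: "y + real k > 0" using assms by simp
    then have "1 / (y + real k) - 1 / (y + real (Suc k)) = 1 / ((y + real k) * (y + real (Suc k)))"
      by (simp add: field_simps)
    also have "\<dots> \<le> 1 / ((y + real k) * (y + real k))"
      using p by (intro divide_left_mono mult_left_mono mult_pos_pos) auto
    finally show "1 / (y + real k) - 1 / (y + real (Suc k)) \<le> 1 / (y + real k)\<^sup>2"
      by (simp add: power2_eq_square)
  qed
qed

text \<open>The derivative of the left-hand side is \<open>y\<close> times the trigamma function, hence at least \<open>1\<close>.
  At \<open>y = 1\<close> the left-hand side is minus the Euler-Mascheroni constant, which exceeds \<open>-1\<close>.\<close>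
lemma Digamma_times_minus_ln_Gamma_gt:
  fixes y :: real
  assumes "y \<ge> 1"
  shows "y * Digamma y - ln_Gamma y > y - 2"
proof -
  let ?G = "\<lambda>s::real. s * Digamma s - ln_Gamma s - s"
  have "?G 1 \<le> ?G y"
  proof (rule DERIV_nonneg_imp_nondecreasing[OF assms])
    fix s :: real assume s: "1 \<le> s" "s \<le> y"
    have "s \<notin> \<int>\<^sub>\<le>\<^sub>0" using s by (auto elim!: nonpos_Ints_cases)
    then have "(?G has_real_derivative s * Polygamma 1 s - 1) (at s)"
      using s by (auto intro!: derivative_eq_intros)
    moreover have "s * Polygamma 1 s - 1 \<ge> 0"
      using trigamma_ge[of s] s by (simp add: field_simps)
    ultimately show "\<exists>d. (?G has_real_derivative d) (at s) \<and> 0 \<le> d" by blast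
  qed
  then show ?thesis using euler_mascheroni_less_13_over_22 by (simp add: ln_Gamma_real_pos)
qed

lemma ln_Gamma_plus_const_div_strict_mono:
  fixes c x y :: real
  assumes "c + 2 \<le> x" "1 \<le> x" "x < y"
  shows "(ln_Gamma x + c) / x < (ln_Gamma y + c) / y"
proof (rule DERIV_pos_imp_increasing[OF assms(3)])
  fix s assume s: "x \<le> s" "s \<le> y"
  have "((\<lambda>s. (ln_Gamma s + c) / s) has_real_derivative
      (s * Digamma s - ln_Gamma s - c) / s\<^sup>2) (at s)"
    using s assms by (auto intro!: derivative_eq_intros simp: power2_eq_square field_simps)
  moreover have "(s * Digamma s - ln_Gamma s - c) / s\<^sup>2 > 0"
    using Digamma_times_minus_ln_Gamma_gt[of s] s assms by (intro divide_pos_pos) auto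
  ultimately show "\<exists>d. ((\<lambda>s. (ln_Gamma s + c) / s) has_real_derivative d) (at s) \<and> d > 0"
    by blast
qed

lemma ln_Gamma_slope_mono:
  fixes a x y :: real
  assumes "a > 0" "0 < x" "x < y"
  shows "(ln_Gamma (x + a) - ln_Gamma a) / x \<le> (ln_Gamma (y + a) - ln_Gamma a) / y"
proof -
  let ?L = "ln \<circ> Gamma :: real \<Rightarrow> real"
  have "?L ((1 - x / y) *\<^sub>R a + (x / y) *\<^sub>R (y + a)) \<le> (1 - x / y) * ?L a + (x / y) * ?L (y + a)"
    using assms by (intro convex_onD[OF log_convex_Gamma_real]) auto
  moreover have "(1 - x / y) *\<^sub>R a + (x / y) *\<^sub>R (y + a) = x + a"
    using assms by (simp add: field_simps)
  ultimately have "ln_Gamma (x + a) \<le> (1 - x / y) * ln_Gamma a + (x / y) * ln_Gamma (y + a)"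
    using assms by (simp add: ln_Gamma_real_pos)
  then show ?thesis using assms by (simp add: field_simps)
qed

section \<open>Monotonicity of the root function\<close>

definition pos_bessel_zero :: "real \<Rightarrow> nat \<Rightarrow> real" where
  "pos_bessel_zero \<mu> n = bessel_zero \<mu> (Suc n)"

lemma separated_sequence_pos_bessel_zero:
  assumes "\<mu> \<ge> 0"
  shows "separated_sequence (pos_bessel_zero \<mu>)"
proof
  show "0 < pos_bessel_zero \<mu> 0"
    using bessel_zero_Suc(1,2)[OF assms, of 0] unfolding pos_bessel_zero_def by linarith
  fix n
  show "pos_bessel_zero \<mu> n + 1 \<le> pos_bessel_zero \<mu> (Suc n)"
    unfolding pos_bessel_zero_def
  proof (rule bessel_reg_zeros_separated[of \<mu>])
    show "-1/2 \<le> \<mu>" using assms by simp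
    show "0 < bessel_zero \<mu> (Suc n)"
      using bessel_zero_Suc(1,2)[OF assms, of n] by linarith
    show "bessel_zero \<mu> (Suc n) < bessel_zero \<mu> (Suc (Suc n))"
      by (rule bessel_zero_Suc(2)[OF assms])
    show "bessel_reg \<mu> (bessel_zero \<mu> (Suc n)) = 0"
      "bessel_reg \<mu> (bessel_zero \<mu> (Suc (Suc n))) = 0"
      by (rule bessel_zero_Suc(3)[OF assms])+
  qed
qed

text \<open>The term \<open>3 * j 0 / x\<close> is added to the Gamma part and subtracted from the zeta part, so that,
  for large \<open>x\<close>, each bracket is monotone on its own.\<close>
lemma ln_theta_eq:
  assumes "\<mu> \<ge> 0" "x \<ge> 2"
  defines "j \<equiv> pos_bessel_zero \<mu>"
  shows "ln (theta \<mu> x) =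
    1 / 2 * ((ln_Gamma (x / 2) + (ln 2 + 3 * j 0)) / (x / 2))
    + 1 / 2 * ((ln_Gamma (x / 2 + (\<mu> + 1)) - ln_Gamma (\<mu> + 1)) / (x / 2))
    + (ln (1 + ratio_tail j x) / x - 3 * j 0 / x) - ln (j 0)"
proof -
  interpret separated_sequence j
    unfolding j_def by (rule separated_sequence_pos_bessel_zero[OF assms(1)])
  have zeta: "bessel_zeta \<mu> x = (1 + ratio_tail j x) / j 0 powr x"
    using suminf_powr_eq[OF assms(2)] unfolding bessel_zeta_def j_def pos_bessel_zero_def .
  have R: "1 + ratio_tail j x > 0" using ratio_tail_nonneg[OF assms(2)] by simp
  have G: "Gamma (\<mu> + 1) > 0" "Gamma (x / 2) > 0" "Gamma (x / 2 + \<mu> + 1) > 0"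
    using assms by (auto intro!: Gamma_real_pos)
  have "ln (theta \<mu> x) = 1 / x * ln (2 / Gamma (\<mu> + 1) * Gamma (x / 2) * Gamma (x / 2 + \<mu> + 1)
      * ((1 + ratio_tail j x) / j 0 powr x))"
    unfolding theta_def zeta by (rule ln_powr)
  also have "\<dots> = 1 / x * (ln 2 - ln_Gamma (\<mu> + 1) + ln_Gamma (x / 2)
      + ln_Gamma (x / 2 + (\<mu> + 1)) + (ln (1 + ratio_tail j x) - x * ln (j 0)))"
  proof -
    have "ln (2 / A * B * C * (T / Q)) = ln 2 - ln A + ln B + ln C + (ln T - ln Q)"
      if "A > 0" "B > 0" "C > 0" "T > 0" "Q > 0" for A B C T Q :: real
      using that by (simp add: ln_mult ln_div)
    from this[OF G R] show ?thesis
      using pos assms(1,2) by (simp add: ln_powr ln_Gamma_real_pos add.assoc)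
  qed
  also have "1 / x * (a - g + p + q + (t - x * l))
      = 1 / 2 * ((p + (a + 3 * k)) / (x / 2)) + 1 / 2 * ((q - g) / (x / 2)) + (t / x - 3 * k / x) - l"
    for a g p q t l k :: real
    using assms(2) by (simp add: field_simps)
  finally show ?thesis .
qed

theorem theorem4p4:
  fixes \<mu> :: real
  assumes "\<mu> \<ge> 0"
  shows "strict_mono_on {x. x > 8 * exp 1 * (\<mu> + 2)\<^sup>2} (\<lambda>x. ln (theta \<mu> x))"
proof (rule strict_mono_onI)
  define j where "j = pos_bessel_zero \<mu>"
  interpret separated_sequence j
    unfolding j_def by (rule separated_sequence_pos_bessel_zero[OF assms])
  fix x y :: real
  assume "x \<in> {x. x > 8 * exp 1 * (\<mu> + 2)\<^sup>2}" and xy: "x < y"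
  then have x: "x > 8 * exp 1 * (\<mu> + 2)\<^sup>2" by simp
  \<comment> \<open>Crude constants suffice: \<open>ln 2 \<le> 1\<close>, \<open>\<pi> < 4\<close> and \<open>e \<ge> 2\<close> reduce the threshold condition
    to \<open>6 \<mu> + 30 \<le> 8 (\<mu> + 2)\<^sup>2\<close>.\<close>
  have "ln 2 \<le> (1 :: real)" using ln_add_one_self_le_self[of 1] by simp
  moreover have "j 0 \<le> 2 * \<mu> + 9"
  proof -
    have "j 0 \<le> max (2 * \<mu> + 1) 1 + 2 * pi"
      using bessel_zero_Suc(4)[OF assms, of 0] unfolding j_def pos_bessel_zero_def by simp
    also have "\<dots> \<le> 2 * \<mu> + 9" using assms pi_less_4 by simp
    finally show ?thesis .
  qed
  moreover have "4 * 2 * (\<mu> + 2)\<^sup>2 \<le> 4 * exp 1 * (\<mu> + 2)\<^sup>2"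
    using exp_ge_add_one_self[of 1] by (intro mult_right_mono) auto
  then have X: "8 * (\<mu> + 2)\<^sup>2 \<le> x / 2" using x by simp
  moreover have "6 * \<mu> + 30 \<le> 8 * (\<mu> + 2)\<^sup>2" using assms by (simp add: power2_sum)
  ultimately have c: "(ln 2 + 3 * j 0) + 2 \<le> x / 2" and X30: "30 \<le> x / 2"
    using assms by auto
  have "(ln_Gamma (x / 2) + (ln 2 + 3 * j 0)) / (x / 2)
      < (ln_Gamma (y / 2) + (ln 2 + 3 * j 0)) / (y / 2)"
    using c X30 xy by (intro ln_Gamma_plus_const_div_strict_mono) auto
  moreover have "(ln_Gamma (x / 2 + (\<mu> + 1)) - ln_Gamma (\<mu> + 1)) / (x / 2)
      \<le> (ln_Gamma (y / 2 + (\<mu> + 1)) - ln_Gamma (\<mu> + 1)) / (y / 2)"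
    using X30 xy assms by (intro ln_Gamma_slope_mono) auto
  moreover have "ln (1 + ratio_tail j x) / x - 3 * j 0 / x
      \<le> ln (1 + ratio_tail j y) / y - 3 * j 0 / y"
    using ln_ratio_tail_decrease[of x y] X30 xy by simp
  moreover have "x \<ge> 2" "y \<ge> 2" using X30 xy by auto
  note ln_theta_eq[OF assms this(1), folded j_def] ln_theta_eq[OF assms this(2), folded j_def]
  ultimately show "ln (theta \<mu> x) < ln (theta \<mu> y)" by linarith
qed

end
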